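(* If $D$ is a (finite) oriented graph with reversal $D'$, then $F(D)=F(D')$.
   Context: An oriented graph is a digraph obtained from a simple graph by giving each edge exactly one direction; if $(u,v)$ is an arc, $v$ is an out-neighbor of $u$. The reversal $D'$ of $D$ has vertex set $V(D)$ and $(u,v)$ is an arc of $D'$ iff $(v,u)$ is an arc of $D$. Oriented $1$-forcing: starting from a nonempty set $S$ of colored vertices, repeatedly, any colored vertex with at most one non-colored out-neighbor forces that out-neighbor to become colored (all forcings in a step simultaneous), until no change occurs; $S$ is a forcing set if all vertices end up colored. $F(D)$ is the minimum size of a forcing set of $D$. *)

theory Defs
  imports "Graph_Theory.Pair_Digraph"
begin

text \<open>
  Simple graphs are rendered, as usual in \<^theory>\<open>Graph_Theory.Pair_Digraph\<close>, by
  \<^const>\<open>pair_graph\<close>: finite, loop-free, with both arcs \<open>(u, v)\<close> and \<open>(v, u)\<close> present for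
  every edge \<open>uv\<close>. In an orientation exactly one of these two arcs is kept.
\<close>

definition orientation_of :: "'a pair_pre_digraph \<Rightarrow> 'a pair_pre_digraph \<Rightarrow> bool" where
  "orientation_of G D \<longleftrightarrow>
     pverts D = pverts G \<and> parcs D \<subseteq> parcs G \<and>
     (\<forall>(u, v) \<in> parcs G. (u, v) \<in> parcs D \<longleftrightarrow> (v, u) \<notin> parcs D)"

definition oriented_graph :: "'a pair_pre_digraph \<Rightarrow> bool" where
  "oriented_graph D \<longleftrightarrow> (\<exists>G. pair_graph G \<and> orientation_of G D)"

definition reversal :: "'a pair_pre_digraph \<Rightarrow> 'a pair_pre_digraph" where
  "reversal D = \<lparr> pverts = pverts D, parcs = (parcs D)\<inverse> \<rparr>"

definition out_neighbors :: "'a pair_pre_digraph \<Rightarrow> 'a \<Rightarrow> 'a set" where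
  "out_neighbors D u = {v. (u, v) \<in> parcs D}"

text \<open>
  One step of the process, applied to the set \<open>C\<close> of colored vertices; all forcings refer to
  the same \<open>C\<close>, so they are simultaneous. The use of \<^const>\<open>card\<close> presupposes finite
  out-neighborhoods.
\<close>

definition force_step :: "'a pair_pre_digraph \<Rightarrow> 'a set \<Rightarrow> 'a set" where
  "force_step D C =
     C \<union> (\<Union>u \<in> {u \<in> C. card (out_neighbors D u - C) \<le> 1}. out_neighbors D u - C)"

text \<open>
  Steps only add vertices and \<open>pverts D\<close> is a fixed point of \<open>force_step D\<close>, so the process
  ends with all vertices colored iff some number of steps reaches \<open>pverts D\<close>.
\<close>

definition forcing_set :: "'a pair_pre_digraph \<Rightarrow> 'a set \<Rightarrow> bool" where
  "forcing_set D S \<longleftrightarrow>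
     S \<noteq> {} \<and> S \<subseteq> pverts D \<and> (\<exists>n. (force_step D ^^ n) S = pverts D)"

text \<open>
  The infimum is an attained minimum unless \<open>D\<close> has no vertices (lemma
  \<open>forcing_number_attained\<close>); for the null graph there is no forcing set and the value is 0.
\<close>

definition forcing_number :: "'a pair_pre_digraph \<Rightarrow> nat" where
  "forcing_number D = Inf (card ` {S. forcing_set D S})"

lemma oriented_graph_iff:
  "oriented_graph D \<longleftrightarrow> pair_digraph D \<and> (\<forall>u v. (u, v) \<in> parcs D \<longrightarrow> (v, u) \<notin> parcs D)"
proof
  assume "oriented_graph D"
  then obtain G where "pair_graph G" and o: "orientation_of G D"
    unfolding oriented_graph_def by blast
  then interpret pair_graph G by simp
  have "pair_digraph D"
    using o wellformed' no_loops' pair_finite_verts finite_subset[OF _ pair_finite_arcs]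
    unfolding orientation_of_def by unfold_locales auto
  with o show "pair_digraph D \<and> (\<forall>u v. (u, v) \<in> parcs D \<longrightarrow> (v, u) \<notin> parcs D)"
    unfolding orientation_of_def by blast
next
  assume r: "pair_digraph D \<and> (\<forall>u v. (u, v) \<in> parcs D \<longrightarrow> (v, u) \<notin> parcs D)"
  then interpret pair_digraph D by simp
  let ?G = "\<lparr> pverts = pverts D, parcs = parcs D \<union> (parcs D)\<inverse> \<rparr>"
  have no_loop: "(b, b) \<notin> parcs D" for b using no_loops' by blast
  have "pair_graph ?G"
    using wellformed' no_loop pair_finite_verts pair_finite_arcs
    by unfold_locales (auto simp: symmetric_def sym_def)
  moreover have "orientation_of ?G D"
    using r unfolding orientation_of_def by auto
  ultimately show "oriented_graph D"
    unfolding oriented_graph_def by blast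
qed

lemma oriented_graph_reversal:
  assumes "oriented_graph D" shows "oriented_graph (reversal D)"
proof -
  from assms interpret pair_digraph D by (simp add: oriented_graph_iff)
  have no_loop: "(b, b) \<notin> parcs D" for b using no_loops' by blast
  have "pair_digraph (reversal D)"
    using wellformed' no_loop pair_finite_verts pair_finite_arcs
    by unfold_locales (auto simp: reversal_def)
  with assms show ?thesis by (auto simp: oriented_graph_iff reversal_def)
qed

lemma force_step_verts:
  assumes "oriented_graph D" shows "force_step D (pverts D) = pverts D"
proof -
  from assms interpret pair_digraph D by (simp add: oriented_graph_iff)
  show ?thesis
    using wellformed' by (auto simp: force_step_def out_neighbors_def)
qed

lemma forcing_number_attained:
  assumes "pverts D \<noteq> {}"
  obtains S where "forcing_set D S" "card S = forcing_number D"
proof -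
  have "(force_step D ^^ 0) (pverts D) = pverts D" by simp
  then have "forcing_set D (pverts D)"
    using assms unfolding forcing_set_def by blast
  then have "forcing_number D \<in> card ` {S. forcing_set D S}"
    unfolding forcing_number_def by (intro Inf_nat_def1) blast
  then show ?thesis using that by force
qed

end

theory Submission
  imports Defs
begin

text \<open>
  Follow a successful process from \<open>S\<close> and choose for each vertex \<open>v \<notin> S\<close> one vertex \<open>p v\<close> that
  forces it. A vertex forces at most once, so \<open>p\<close> is injective and the set \<open>T\<close> of vertices that
  never force has the size of \<open>S\<close>. From \<open>T\<close> the reversal runs the same forcings backwards: if
  \<open>x \<noteq> p v\<close> is an in-neighbor of \<open>v\<close> that forces some \<open>y\<close>, then \<open>v\<close> was colored before \<open>y\<close>, so in
  the reversed order \<open>x\<close> is already colored when \<open>v\<close> has to force \<open>p v\<close>.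
\<close>

lemma reversal_reversal [simp]: "reversal (reversal D) = D"
  by (simp add: reversal_def)

lemma (in pair_fin_digraph) pair_fin_digraph_reversal: "pair_fin_digraph (reversal G)"
  using wellformed' pair_finite_verts pair_finite_arcs
  by unfold_locales (auto simp: reversal_def)

lemma force_step_iterate_mono:
  assumes "m \<le> n"
  shows "(force_step D ^^ m) S \<subseteq> (force_step D ^^ n) S"
  using assms by (rule lift_Suc_mono_le[rotated]) (auto simp: force_step_def)

lemma (in pair_fin_digraph) finite_out_neighbors: "finite (out_neighbors G u)"
  using wellformed' by (auto simp: out_neighbors_def intro: finite_subset[OF _ pair_finite_verts])

lemma (in pair_fin_digraph) force_step_iterate_subset:
  assumes "S \<subseteq> pverts G"
  shows "(force_step G ^^ n) S \<subseteq> pverts G"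
proof (induction n)
  case (Suc n)
  then show ?case using wellformed' by (auto simp: force_step_def out_neighbors_def)
qed (use assms in simp)

text \<open>The iterates grow inside a finite set, so one of largest size equals its
  successor.\<close>

lemma (in pair_fin_digraph) force_step_iterate_fixed_point:
  assumes "S \<subseteq> pverts G"
  obtains n where "force_step G ((force_step G ^^ n) S) = (force_step G ^^ n) S"
proof -
  let ?C = "\<lambda>n. (force_step G ^^ n) S"
  have sub: "?C n \<subseteq> pverts G" for n
    using assms by (rule force_step_iterate_subset)
  have "card (?C n) < Suc (card (pverts G))" for n
    using card_mono[OF pair_finite_verts sub[of n]] by simp
  then obtain n where n: "\<And>m. card (?C m) \<le> card (?C n)"
    using ex_has_greatest_nat[of "\<lambda>_. True" 0 "\<lambda>n. card (?C n)"] by blast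
  have "?C n = ?C (Suc n)"
    using finite_subset[OF sub pair_finite_verts] force_step_iterate_mono n
    by (rule card_seteq) simp
  then show thesis by (intro that[of n]) simp
qed

text \<open>This removes step counts: to show that the reversed process succeeds, it suffices to
  study a colored set that a further step leaves unchanged.\<close>

lemma (in pair_fin_digraph) forcing_setI:
  assumes "S \<noteq> {}" "S \<subseteq> pverts G"
    and closed: "\<And>C. S \<subseteq> C \<Longrightarrow> C \<subseteq> pverts G \<Longrightarrow> force_step G C = C \<Longrightarrow> C = pverts G"
  shows "forcing_set G S"
proof -
  obtain n where "force_step G ((force_step G ^^ n) S) = (force_step G ^^ n) S"
    using force_step_iterate_fixed_point assms(2) .
  moreover have "S \<subseteq> (force_step G ^^ n) S"
    using force_step_iterate_mono[of 0 n] by simp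
  ultimately have "(force_step G ^^ n) S = pverts G"
    using closed force_step_iterate_subset[OF assms(2)] by blast
  then show ?thesis using assms(1,2) unfolding forcing_set_def by blast
qed

lemma force_step_closedD:
  assumes "force_step D C = C" "v \<in> C" "(v, w) \<in> parcs D"
    and "\<And>x. (v, x) \<in> parcs D \<Longrightarrow> x \<noteq> w \<Longrightarrow> x \<in> C"
  shows "w \<in> C"
proof -
  have "out_neighbors D v - C \<subseteq> {w}"
    using assms(4) by (auto simp: out_neighbors_def)
  then have "card (out_neighbors D v - C) \<le> 1"
    using card_mono[of "{w}"] by fastforce
  then have "w \<in> force_step D C"
    using assms(2,3) by (auto simp: force_step_def out_neighbors_def)
  then show ?thesis using assms(1) by simp
qed

text \<open>Here \<open>t v\<close> is the step at which \<open>v\<close> gets colored and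
  \<open>p v\<close> a vertex forcing it then. The last property holds because \<open>v\<close> is
  the only out-neighbor of \<open>p v\<close> still uncolored just before that step.\<close>

lemma (in pair_fin_digraph) forcing_set_forcers:
  assumes "forcing_set G S"
  obtains p and t :: "'a \<Rightarrow> nat"
  where "\<And>v. v \<in> pverts G - S \<Longrightarrow> (p v, v) \<in> parcs G"
    and "\<And>v. v \<in> pverts G - S \<Longrightarrow> t (p v) < t v"
    and "\<And>v x. v \<in> pverts G - S \<Longrightarrow> (p v, x) \<in> parcs G \<Longrightarrow> x \<noteq> v \<Longrightarrow> t x < t v"
proof -
  let ?C = "\<lambda>n. (force_step G ^^ n) S"
  define t where "t v = (LEAST n. v \<in> ?C n)" for v
  obtain N where N: "?C N = pverts G"
    using assms unfolding forcing_set_def by blast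
  have t_le: "t v \<le> n" if "v \<in> ?C n" for v n
    unfolding t_def using that by (rule Least_le)
  have in_t: "v \<in> ?C (t v)" if "v \<in> pverts G" for v
    unfolding t_def using that by (intro LeastI[where P = "\<lambda>n. v \<in> ?C n" and k = N]) (simp add: N)
  have "\<forall>v \<in> pverts G - S. \<exists>u. (u, v) \<in> parcs G \<and> t u < t v \<and>
      (\<forall>x. (u, x) \<in> parcs G \<longrightarrow> x \<noteq> v \<longrightarrow> t x < t v)"
    (is "\<forall>v \<in> _. \<exists>u. ?forces u v")
  proof
    fix v assume v: "v \<in> pverts G - S"
    \<comment> \<open>Stage 0 is \<open>S\<close> itself, so there is a stage \<open>n\<close> just
      before \<open>v\<close> gets colored.\<close>
    have "t v \<noteq> 0"
      using v in_t[of v] by (metis DiffD1 DiffD2 funpow_0)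
    then obtain n where n: "t v = Suc n" by (cases "t v") auto
    have "v \<notin> ?C n" using t_le[of v n] n by auto
    moreover have "v \<in> force_step G (?C n)"
      using in_t[of v] v n by simp
    ultimately obtain u where u: "u \<in> ?C n" "card (out_neighbors G u - ?C n) \<le> 1"
        "v \<in> out_neighbors G u - ?C n"
      unfolding force_step_def by blast
    have "x = v" if "x \<in> out_neighbors G u - ?C n" for x
      using card_le_Suc0_iff_eq[OF finite_Diff[OF finite_out_neighbors]] u(2,3) that
      unfolding One_nat_def by blast
    then have "t x < t v" if "(u, x) \<in> parcs G" "x \<noteq> v" for x
      using that t_le[of x n] n by (fastforce simp: out_neighbors_def)
    with u t_le[of u n] n
    show "\<exists>u. ?forces u v"
      by (intro exI[of _ u]) (auto simp: out_neighbors_def)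
  qed
  then obtain p where "\<forall>v \<in> pverts G - S. ?forces (p v) v"
    unfolding bchoice_iff by blast
  then show thesis by (intro that[of p t]) blast+
qed

lemma (in pair_fin_digraph) forcing_set_reversal:
  assumes "forcing_set G S"
  obtains T where "forcing_set (reversal G) T" "card T = card S"
proof -
  obtain p and t :: "'a \<Rightarrow> nat"
    where arc: "\<And>v. v \<in> pverts G - S \<Longrightarrow> (p v, v) \<in> parcs G"
      and earlier: "\<And>v. v \<in> pverts G - S \<Longrightarrow> t (p v) < t v"
      and others: "\<And>v x. v \<in> pverts G - S \<Longrightarrow> (p v, x) \<in> parcs G \<Longrightarrow> x \<noteq> v \<Longrightarrow> t x < t v"
    using forcing_set_forcers[OF assms] by blast
  have S: "S \<noteq> {}" "S \<subseteq> pverts G"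
    using assms unfolding forcing_set_def by auto
  let ?W = "pverts G - S"
  let ?T = "pverts G - p ` ?W"
  have fin: "finite S" using S(2) pair_finite_verts by (rule finite_subset)
  \<comment> \<open>Two distinct vertices with the same forcer would each be colored strictly before
    the other.\<close>
  have inj: "inj_on p ?W"
  proof (rule inj_onI)
    fix v w assume "v \<in> ?W" "w \<in> ?W" "p v = p w"
    then show "v = w"
      using arc[of v] arc[of w] others[of v w] others[of w v] by force
  qed
  have sub: "p ` ?W \<subseteq> pverts G"
    using arc wellformed' by fastforce
  have card: "card ?T = card S"
    using sub S(2) fin card_mono[OF pair_finite_verts S(2)]
    by (simp add: card_Diff_subset card_image[OF inj] finite_subset[OF sub])
  interpret R: pair_fin_digraph "reversal G" by (rule pair_fin_digraph_reversal)
  have "forcing_set (reversal G) ?T"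
  proof (rule R.forcing_setI)
    show "?T \<noteq> {}" using card S(1) fin by (metis card_eq_0_iff)
    show "?T \<subseteq> pverts (reversal G)" by (auto simp: reversal_def)
    fix C
    assume C: "?T \<subseteq> C" "C \<subseteq> pverts (reversal G)" "force_step (reversal G) C = C"
    let ?M = "Max (t ` pverts G)"
    have "p v \<in> C" if "v \<in> ?W" for v
      using that
    \<comment> \<open>The induction runs from the vertices colored last to those colored first; the
      bound \<open>?M\<close> on all times keeps the truncated subtraction strictly
      decreasing.\<close>
    proof (induction "?M - t v" arbitrary: v rule: less_induct)
      case less
      \<comment> \<open>Either \<open>x\<close> is no chosen forcer and lies in \<open>?T\<close>,
        or it forces some \<open>y\<close> colored after \<open>v\<close>, to which the induction
        hypothesis applies.\<close>
      have later: "x \<in> C" if x: "x \<in> pverts G"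
        and after: "\<And>y. y \<in> ?W \<Longrightarrow> x = p y \<Longrightarrow> t v < t y" for x
      proof (cases "x \<in> p ` ?W")
        case True
        then obtain y where y: "y \<in> ?W" "x = p y" by blast
        then have "t y \<le> ?M" using pair_finite_verts by simp
        with after[OF y] have "?M - t y < ?M - t v" by linarith
        with less.hyps y show ?thesis by simp
      qed (use C(1) x in auto)
      show ?case
      proof (rule force_step_closedD[OF C(3)])
        show "v \<in> C" using earlier less.prems by (intro later) auto
        show "(v, p v) \<in> parcs (reversal G)"
          using arc less.prems by (simp add: reversal_def)
        \<comment> \<open>If \<open>x = p y\<close>, then \<open>y \<noteq> v\<close>, and
          \<open>v\<close> is another out-neighbor of \<open>p y\<close>; hence
          \<open>t v < t y\<close> by \<open>others\<close>.\<close>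
        fix x assume "(v, x) \<in> parcs (reversal G)" "x \<noteq> p v"
        then show "x \<in> C"
          using others wellformed' by (intro later) (auto simp: reversal_def)
      qed
    qed
    \<comment> \<open>\<open>C\<close> contains \<open>?T\<close> and all chosen forcers, which
      together are all vertices.\<close>
    with C show "C = pverts (reversal G)" by (auto simp: reversal_def)
  qed
  with card show thesis using that by blast
qed

theorem theorem2p8:
  fixes D :: "'a pair_pre_digraph"
  assumes "oriented_graph D"
  shows "forcing_number D = forcing_number (reversal D)"
proof -
  interpret pair_digraph D using assms by (simp add: oriented_graph_iff)
  interpret R: pair_fin_digraph "reversal D" by (rule pair_fin_digraph_reversal)
  have "card ` {S. forcing_set D S} = card ` {S. forcing_set (reversal D) S}"
  proof (intro equalityI image_subsetI)
    fix S assume "S \<in> {S. forcing_set D S}"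
    then obtain T where "forcing_set (reversal D) T" "card T = card S"
      using forcing_set_reversal by blast
    then show "card S \<in> card ` {S. forcing_set (reversal D) S}" by (metis imageI mem_Collect_eq)
  next
    fix S assume "S \<in> {S. forcing_set (reversal D) S}"
    \<comment> \<open>The lemma for the reversal speaks of the double reversal, which simplifies to
      \<open>D\<close>.\<close>
    then obtain T where "forcing_set D T" "card T = card S"
      using R.forcing_set_reversal by auto
    then show "card S \<in> card ` {S. forcing_set D S}" by (metis imageI mem_Collect_eq)
  qed
  then show ?thesis unfolding forcing_number_def by (rule arg_cong)
qed

end
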